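(* Let $X$ be a spectrally negative Lévy process which has a Gaussian component, i.e. whose Gaussian coefficient satisfies $\sigma>0$. Then for each fixed $q\ge 0$ the $q$-scale function $W^{(q)}$ of $X$, restricted to $(0,\infty)$, belongs to $C^2(0,\infty)$.
   Context: A spectrally negative Lévy process $X=\{X_t:t\ge 0\}$ is a real-valued process, started from $0$ under the probability $P$, with almost surely right-continuous paths with left limits, stationary independent increments and no positive jumps; as usual it is assumed not to have monotone decreasing paths. Its Laplace exponent $\psi$ is defined by $E(e^{\theta X_t})=e^{t\psi(\theta)}$ and is finite for all $\theta\ge 0$, with $\psi(0+)=0$ and $\psi(\infty)=\infty$. It has the form $$\psi(\theta)=a\theta+\tfrac12\sigma^2\theta^2+\int_{(-\infty,0)}\bigl(e^{\theta x}-1-\theta x\mathbf 1_{(x>-1)}\bigr)\,\Pi(\mathrm dx),$$ where $a\in\mathbb R$, $\sigma\ge 0$ is the Gaussian coefficient, and $\Pi$ is the Lévy measure, a measure on $(-\infty,0)$ with $\int_{(-\infty,0)}(1\wedge x^2)\,\Pi(\mathrm dx)<\infty$. For $q\ge 0$, $\Phi(q)$ denotes the largest root in $[0,\infty)$ of $\psi(\theta)=q$. The $q$-scale function $W^{(q)}:\mathbb R\to[0,\infty)$ is the function with $W^{(q)}(x)=0$ for $x<0$, continuous on $[0,\infty)$, with $$\int_0^\infty e^{-\theta x}W^{(q)}(x)\,\mathrm dx=\frac{1}{\psi(\theta)-q}\qquad\text{for }\theta>\Phi(q).$$ *)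

theory Defs
  imports "HOL-Probability.Probability"
begin

locale spectrally_negative_levy_process = prob_space M
  for M :: "'w measure" and X :: "real \<Rightarrow> 'w \<Rightarrow> real" +
  assumes random_variable: "0 \<le> t \<Longrightarrow> random_variable borel (X t)"
    and starts_at_0: "AE \<omega> in M. X 0 \<omega> = 0"
    and right_continuous: "AE \<omega> in M. \<forall>t\<ge>0. continuous (at_right t) (\<lambda>s. X s \<omega>)"
    and left_limits: "AE \<omega> in M. \<forall>t>0. \<exists>l. ((\<lambda>s. X s \<omega>) \<longlongrightarrow> l) (at_left t)"
    and stationary_increments: "0 \<le> s \<Longrightarrow> 0 \<le> h \<Longrightarrow>
      distr M borel (\<lambda>\<omega>. X (s + h) \<omega> - X s \<omega>) = distr M borel (\<lambda>\<omega>. X h \<omega> - X 0 \<omega>)"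
    and independent_increments: "\<And>(t :: nat \<Rightarrow> real) n. 0 \<le> t 0 \<Longrightarrow> mono t \<Longrightarrow>
      indep_vars (\<lambda>_. borel) (\<lambda>i \<omega>. X (t (Suc i)) \<omega> - X (t i) \<omega>) {..<n}"
    and no_positive_jumps: "AE \<omega> in M. \<forall>t>0. X t \<omega> - Lim (at_left t) (\<lambda>s. X s \<omega>) \<le> 0"
    and not_decreasing: "\<not> (AE \<omega> in M. antimono_on {0..} (\<lambda>t. X t \<omega>))"

text \<open>Only the values of \<open>\<psi>\<close> on \<open>[0, \<infinity>)\<close> are meaningful; integrability is the finiteness
  of the exponential moments.\<close>

definition has_laplace_exponent ::
    "'w measure \<Rightarrow> (real \<Rightarrow> 'w \<Rightarrow> real) \<Rightarrow> (real \<Rightarrow> real) \<Rightarrow> bool" where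
  "has_laplace_exponent M X \<psi> \<longleftrightarrow>
    (\<forall>\<theta>\<ge>0. \<forall>t\<ge>0. integrable M (\<lambda>\<omega>. exp (\<theta> * X t \<omega>)) \<and>
       (LINT \<omega>|M. exp (\<theta> * X t \<omega>)) = exp (t * \<psi> \<theta>))"

text \<open>A measure on the negative half-line is represented as a Borel measure on the reals that
  gives no mass to \<open>[0, \<infinity>)\<close>.\<close>

definition negative_levy_measure :: "real measure \<Rightarrow> bool" where
  "negative_levy_measure \<nu> \<longleftrightarrow> sets \<nu> = sets borel \<and> emeasure \<nu> {0..} = 0 \<and>
    (\<integral>\<^sup>+x\<in>{..<0}. ennreal (min 1 (x\<^sup>2)) \<partial>\<nu>) < \<infinity>"

definition levy_khintchine_exponent ::
    "real \<Rightarrow> real \<Rightarrow> real measure \<Rightarrow> real \<Rightarrow> real" where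
  "levy_khintchine_exponent a \<sigma> \<nu> \<theta> =
    a * \<theta> + \<sigma>\<^sup>2 * \<theta>\<^sup>2 / 2 +
    (LINT x:{..<0}|\<nu>. exp (\<theta> * x) - 1 - \<theta> * x * indicator {-1<..} x)"

definition largest_root :: "(real \<Rightarrow> real) \<Rightarrow> real \<Rightarrow> real" where
  "largest_root \<psi> q = (GREATEST \<theta>. 0 \<le> \<theta> \<and> \<psi> \<theta> = q)"

definition is_scale_function :: "(real \<Rightarrow> real) \<Rightarrow> real \<Rightarrow> (real \<Rightarrow> real) \<Rightarrow> bool" where
  "is_scale_function \<psi> q W \<longleftrightarrow>
    (\<forall>x. 0 \<le> W x) \<and> (\<forall>x<0. W x = 0) \<and> continuous_on {0..} W \<and>
    (\<forall>\<theta>>largest_root \<psi> q.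
       set_integrable lborel {0..} (\<lambda>x. exp (- \<theta> * x) * W x) \<and>
       (LINT x:{0..}|lborel. exp (- \<theta> * x) * W x) = 1 / (\<psi> \<theta> - q))"

definition C2_on :: "real set \<Rightarrow> (real \<Rightarrow> real) \<Rightarrow> bool" where
  "C2_on S f \<longleftrightarrow> (\<exists>f' f''.
    (\<forall>x\<in>S. (f has_real_derivative f' x) (at x)) \<and>
    (\<forall>x\<in>S. (f' has_real_derivative f'' x) (at x)) \<and>
    continuous_on S f'')"

end

theory Submission
  imports Defs
begin

text \<open>
  The Gaussian part of the exponent makes the scale function the solution of a Volterra equation
  of the second kind. Put \<open>c = \<sigma>\<^sup>2 / 2\<close>. Two integrations by parts of the jump integral show that
  \<open>\<psi>(\<theta>) - q = \<theta>\<^sup>2 (c + K(\<theta>))\<close>, where \<open>K\<close> is the Laplace transform of a function \<open>k\<close> that is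
  continuous on \<open>(0, \<infinity>)\<close>; it is \<open>a - q y\<close> plus the average over the jumps of an explicit kernel
  (\<open>laplace_of_levy_khintchine\<close>). Since \<open>x\<^sup>2\<close> is integrable near 0 for the jump measure, \<open>k\<close> is
  integrable near 0 and \<open>y k(y)\<close> stays bounded there, although \<open>k\<close> itself may blow up.

  Expanding \<open>1 / (\<theta>\<^sup>2 (c + K))\<close> in powers of \<open>K / c\<close> suggests that the second derivative of the scale
  function has to be \<open>v = (1 / c) (f + f * f + f * f * f + \<dots>)\<close> with \<open>f = - k / c\<close> and \<open>*\<close> the
  convolution. After multiplication by a decaying exponential the \<open>L\<^sup>1\<close> norm of \<open>f\<close> is less than 1
  and the series converges in \<open>L\<^sup>1\<close>. The point is that it also converges to a function continuous on
  \<open>(0, \<infinity>)\<close>. Multiplication by \<open>x\<close> is a derivation of the convolution algebra,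
  \<open>x (f * g) = (x f) * g + f * (x g)\<close>, and a bounded function convolved with an integrable one is
  continuous if the bounded one is continuous off a null set. Hence convolution preserves the class
  of integrable \<open>f\<close> that are continuous on \<open>(0, \<infinity>)\<close> with \<open>x f(x)\<close> bounded (\<open>tame_conv\<close>), and
  the \<open>n\<close>-th convolution power has \<open>\<bar>x f\<^sup>*\<^sup>n(x)\<bar> \<le> n N r\<^sup>n\<^sup>-\<^sup>1\<close> with \<open>r < 1\<close> the \<open>L\<^sup>1\<close> norm and \<open>N\<close> a
  bound of \<open>x f(x)\<close>. So the series converges locally uniformly on \<open>(0, \<infinity>)\<close> (\<open>neumann_series\<close>).

  Integrating \<open>v\<close> twice, with slope \<open>1 / c\<close> and value 0 at the origin, gives a function of class
  \<open>C\<^sup>2\<close> on \<open>(0, \<infinity>)\<close> whose Laplace transform is \<open>1 / (\<psi>(\<theta>) - q)\<close> for large \<open>\<theta>\<close>. Uniqueness of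
  Laplace transforms of continuous functions (\<open>laplace_unique\<close>) identifies it with the scale
  function.
\<close>

section \<open>Convolution\<close>

definition conv :: "(real \<Rightarrow> real) \<Rightarrow> (real \<Rightarrow> real) \<Rightarrow> real \<Rightarrow> real" where
  "conv f g x = (LINT y|lborel. f y * g (x - y))"

lemma lborel_integral_shift:
  fixes g :: "real \<Rightarrow> real"
  assumes "integrable lborel g"
  shows "integrable lborel (\<lambda>x. g (x - y))" "(LINT x|lborel. g (x - y)) = (LINT x|lborel. g x)"
    "integrable lborel (\<lambda>x. g (y - x))" "(LINT x|lborel. g (y - x)) = (LINT x|lborel. g x)"
  using lborel_integrable_real_affine[OF assms, of 1 "- y"] lborel_integral_real_affine[of 1 g "- y"]
    lborel_integrable_real_affine[OF assms, of "-1" y] lborel_integral_real_affine[of "-1" g y]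
  by simp_all

lemma conv_integrable:
  assumes f: "integrable lborel f" and g: "integrable lborel g"
  shows "integrable lborel (conv f g)"
    and "(LINT x|lborel. conv f g x) = (LINT x|lborel. f x) * (LINT x|lborel. g x)"
    and "(LINT x|lborel. \<bar>conv f g x\<bar>) \<le> (LINT x|lborel. \<bar>f x\<bar>) * (LINT x|lborel. \<bar>g x\<bar>)"
proof -
  have main: "integrable lborel (conv f g)"
    "(LINT x|lborel. conv f g x) = (LINT x|lborel. f x) * (LINT x|lborel. g x)"
    "AE x in lborel. integrable lborel (\<lambda>y. f y * g (x - y))"
    if f: "integrable lborel f" and g: "integrable lborel g" for f g
  proof -
    have [measurable]: "f \<in> borel_measurable borel" "g \<in> borel_measurable borel"
      using f g by (simp_all add: borel_measurable_integrable)
    have pair: "integrable (lborel \<Otimes>\<^sub>M lborel) (\<lambda>(y, x). f y * g (x - y))"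
    proof (rule lborel_pair.Fubini_integrable)
      show "integrable lborel (\<lambda>y. LINT x|lborel. norm (case (y, x) of (y, x) \<Rightarrow> f y * g (x - y)))"
        using f g lborel_integral_shift(2)[of "\<lambda>x. \<bar>g x\<bar>"] by (simp add: abs_mult)
      show "AE y in lborel. integrable lborel (\<lambda>x. case (y, x) of (y, x) \<Rightarrow> f y * g (x - y))"
        using g lborel_integral_shift(1) by simp
    qed simp
    then show "integrable lborel (conv f g)"
      using lborel_pair.integrable_snd[OF pair] by (simp add: conv_def[abs_def])
    show "(LINT x|lborel. conv f g x) = (LINT x|lborel. f x) * (LINT x|lborel. g x)"
      using lborel_pair.Fubini_integral[OF pair] lborel_integral_shift(2)[OF g]
      by (simp add: conv_def[abs_def])
    show "AE x in lborel. integrable lborel (\<lambda>y. f y * g (x - y))"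
      using lborel_pair.AE_integrable_snd[OF pair] by simp
  qed
  show "integrable lborel (conv f g)"
    "(LINT x|lborel. conv f g x) = (LINT x|lborel. f x) * (LINT x|lborel. g x)"
    using main f g by auto
  have fa: "integrable lborel (\<lambda>x. \<bar>f x\<bar>)" and ga: "integrable lborel (\<lambda>x. \<bar>g x\<bar>)" using f g by auto
  have "(LINT x|lborel. \<bar>conv f g x\<bar>) \<le> (LINT x|lborel. conv (\<lambda>y. \<bar>f y\<bar>) (\<lambda>y. \<bar>g y\<bar>) x)"
  proof (rule integral_mono)
    show "\<bar>conv f g x\<bar> \<le> conv (\<lambda>y. \<bar>f y\<bar>) (\<lambda>y. \<bar>g y\<bar>) x" for x
      unfolding conv_def using integral_abs_bound[of lborel "\<lambda>y. f y * g (x - y)"] by (simp add: abs_mult)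
  qed (use main f g fa ga in auto)
  also have "\<dots> = (LINT x|lborel. \<bar>f x\<bar>) * (LINT x|lborel. \<bar>g x\<bar>)"
    by (rule main(2)[OF fa ga])
  finally show "(LINT x|lborel. \<bar>conv f g x\<bar>) \<le> \<dots>" .
qed

text \<open>
  The half-line is built in by requiring \<open>f\<close> to vanish on \<open>(-\<infinity>, 0]\<close>, so that convolution over the whole
  line is the convolution of the half-line. The bound allows a singularity of order \<open>1 / x\<close> at the origin.
\<close>

definition tame :: "real \<Rightarrow> (real \<Rightarrow> real) \<Rightarrow> bool" where
  "tame N f \<longleftrightarrow> (\<forall>x\<le>0. f x = 0) \<and> integrable lborel f \<and> continuous_on {0<..} f \<and> (\<forall>x. \<bar>x * f x\<bar> \<le> N)"

text \<open>
  Dominated convergence with the fixed majorant \<open>N \<bar>g\<bar>\<close>: for each \<open>x\<close> the integrand fails to be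
  continuous in \<open>x\<close> only at \<open>y = x\<close>. The exception is essential, since \<open>x f(x)\<close> can jump at the origin.
\<close>

lemma continuous_conv_bounded:
  fixes F g :: "real \<Rightarrow> real"
  assumes F: "F \<in> borel_measurable borel" "\<And>x. \<bar>F x\<bar> \<le> N" "\<And>x. x \<noteq> 0 \<Longrightarrow> isCont F x"
    and g: "integrable lborel g"
  shows "continuous_on UNIV (\<lambda>x. LINT y|lborel. g y * F (x - y))"
proof (rule continuous_at_imp_continuous_on, rule ballI)
  fix x
  have [measurable]: "g \<in> borel_measurable borel" "F \<in> borel_measurable borel"
    using F g by (simp_all add: borel_measurable_integrable)
  show "isCont (\<lambda>x. LINT y|lborel. g y * F (x - y)) x"
    unfolding continuous_at_sequentially comp_def
  proof (intro allI impI)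
    fix u assume u: "u \<longlonglongrightarrow> x"
    show "(\<lambda>n. LINT y|lborel. g y * F (u n - y)) \<longlonglongrightarrow> (LINT y|lborel. g y * F (x - y))"
    proof (rule integral_dominated_convergence[where w="\<lambda>y. N * \<bar>g y\<bar>"])
      show "AE y in lborel. (\<lambda>n. g y * F (u n - y)) \<longlonglongrightarrow> g y * F (x - y)"
        using AE_lborel_singleton[of x]
      proof eventually_elim
        case (elim y)
        then have "isCont F (x - y)" by (intro F(3)) simp
        then show ?case
          by (intro tendsto_intros isCont_tendsto_compose[of "x - y" F] u) auto
      qed
      show "AE y in lborel. norm (g y * F (u n - y)) \<le> N * \<bar>g y\<bar>" for n
        using mult_left_mono[OF F(2) abs_ge_zero] by (auto simp: abs_mult mult.commute)
    qed (use g in auto)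
  qed
qed

text \<open>
  The splitting \<open>x = y + (x - y)\<close> writes \<open>x (f * g)(x)\<close> as a sum of two convolutions, each of a bounded
  function with an integrable one. This yields the continuity and at the same time the bound, which
  has the shape of the Leibniz rule.
\<close>

lemma tame_conv:
  assumes f: "tame M f" and g: "tame N g"
  shows "tame (M * (LINT y|lborel. \<bar>g y\<bar>) + N * (LINT y|lborel. \<bar>f y\<bar>)) (conv f g)"
proof -
  have f0: "f x = 0" and g0: "g x = 0" if "x \<le> 0" for x
    using f g that by (auto simp: tame_def)
  have fi: "integrable lborel f" and gi: "integrable lborel g"
    using f g by (auto simp: tame_def)
  have [measurable]: "f \<in> borel_measurable borel" "g \<in> borel_measurable borel"
    using fi gi by (simp_all add: borel_measurable_integrable)
  have fM: "\<bar>x * f x\<bar> \<le> M" and gN: "\<bar>x * g x\<bar> \<le> N" for x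
    using f g by (auto simp: tame_def)
  have cont: "isCont (\<lambda>x. x * f x) x" if "tame K f" "x \<noteq> 0" for f K x
  proof (cases "x < 0")
    case True
    have "isCont (\<lambda>x. x * f x) x \<longleftrightarrow> isCont (\<lambda>x. 0::real) x"
      using that True by (intro isCont_cong eventually_mono[OF eventually_nhds_in_open[of "{..<0}"]])
        (auto simp: tame_def)
    then show ?thesis by simp
  next
    case False
    then have "isCont f x"
      using that by (simp add: tame_def continuous_on_eq_continuous_at)
    then show ?thesis by (intro continuous_intros)
  qed
  have i1: "integrable lborel (\<lambda>y. f y * ((x - y) * g (x - y)))" for x
  proof (rule Bochner_Integration.integrable_bound[where f="\<lambda>y. N * f y"])
    have "\<bar>f y\<bar> * \<bar>(x - y) * g (x - y)\<bar> \<le> \<bar>f y\<bar> * \<bar>N\<bar>" for y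
      using gN[of "x - y"] by (intro mult_left_mono) auto
    then show "AE y in lborel. norm (f y * ((x - y) * g (x - y))) \<le> norm (N * f y)"
      by (simp add: abs_mult mult.commute)
  qed (use fi in auto)
  have i2: "integrable lborel (\<lambda>y. y * f y * g (x - y))" for x
  proof (rule Bochner_Integration.integrable_bound[where f="\<lambda>y. M * g (x - y)"])
    have "\<bar>y * f y\<bar> * \<bar>g (x - y)\<bar> \<le> \<bar>M\<bar> * \<bar>g (x - y)\<bar>" for y
      using fM[of y] by (intro mult_right_mono) auto
    then show "AE y in lborel. norm (y * f y * g (x - y)) \<le> norm (M * g (x - y))"
      by (simp add: abs_mult)
  qed (use lborel_integral_shift(3)[OF gi] in auto)
  \<comment> \<open>the substitution of \<open>x - y\<close> for \<open>y\<close> brings the first term into the form of the continuity lemma\<close>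
  have eq: "x * conv f g x = (LINT y|lborel. g y * ((x - y) * f (x - y))) + (LINT y|lborel. f y * ((x - y) * g (x - y)))" for x
  proof -
    have "x * conv f g x = (LINT y|lborel. y * f y * g (x - y) + f y * ((x - y) * g (x - y)))"
      unfolding conv_def Bochner_Integration.integral_mult_right_zero[symmetric]
      by (intro Bochner_Integration.integral_cong) (auto simp: algebra_simps)
    also have "\<dots> = (LINT y|lborel. y * f y * g (x - y)) + (LINT y|lborel. f y * ((x - y) * g (x - y)))"
      using i1 i2 by (rule Bochner_Integration.integral_add[rotated])
    also have "(LINT y|lborel. y * f y * g (x - y)) = (LINT y|lborel. g y * ((x - y) * f (x - y)))"
      using lborel_integral_real_affine[of "-1" "\<lambda>y. y * f y * g (x - y)" x] by (simp add: mult.commute)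
    finally show ?thesis .
  qed
  have "continuous_on UNIV (\<lambda>x. x * conv f g x)"
    unfolding eq
    by (intro continuous_on_add continuous_conv_bounded[where N=M] continuous_conv_bounded[where N=N])
      (use fM gN fi gi cont[OF f] cont[OF g] in auto)
  then have "continuous_on {0<..} (\<lambda>x. x * conv f g x / x)"
    using continuous_on_subset[OF _ subset_UNIV]
    by (intro continuous_on_divide continuous_on_id) auto
  then have c: "continuous_on {0<..} (conv f g)"
    by (rule continuous_on_eq) simp
  have z: "conv f g x = 0" if "x \<le> 0" for x
  proof -
    have "f y * g (x - y) = 0" for y using f0[of y] g0[of "x - y"] that by (cases "y \<le> 0") auto
    then show ?thesis by (simp only: conv_def) simp
  qed
  have b: "\<bar>x * conv f g x\<bar> \<le> M * (LINT y|lborel. \<bar>g y\<bar>) + N * (LINT y|lborel. \<bar>f y\<bar>)" for x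
  proof -
    have bd: "\<bar>LINT y|lborel. g y * F (x - y)\<bar> \<le> K * (LINT y|lborel. \<bar>g y\<bar>)"
      if "\<And>y. \<bar>F y\<bar> \<le> K" "integrable lborel g" for F g :: "real \<Rightarrow> real" and K
    proof -
      have "\<bar>LINT y|lborel. g y * F (x - y)\<bar> \<le> (LINT y|lborel. \<bar>g y * F (x - y)\<bar>)"
        by (rule integral_abs_bound)
      also have "\<dots> \<le> (LINT y|lborel. K * \<bar>g y\<bar>)"
        using that(2) mult_left_mono[OF that(1) abs_ge_zero] order_trans[OF abs_ge_zero that(1)]
        by (intro integral_mono') (auto simp: abs_mult mult.commute)
      finally show ?thesis by simp
    qed
    show ?thesis unfolding eq
      by (rule order_trans[OF abs_triangle_ineq], rule add_mono) (intro bd fM gN gi fi)+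
  qed
  show ?thesis using z c b conv_integrable(1)[OF fi gi] by (simp add: tame_def)
qed

section \<open>The Neumann series of convolution powers\<close>

text \<open>
  The exponent is shifted by one, as convolution of functions has no unit: \<open>conv_power f n\<close> is the
  product of \<open>n + 1\<close> factors.
\<close>

primrec conv_power :: "(real \<Rightarrow> real) \<Rightarrow> nat \<Rightarrow> real \<Rightarrow> real" where
  "conv_power f 0 = f"
| "conv_power f (Suc n) = conv f (conv_power f n)"

lemma conv_power_integrable:
  assumes f: "integrable lborel f"
  shows "integrable lborel (conv_power f n)
    \<and> (LINT x|lborel. conv_power f n x) = (LINT x|lborel. f x) ^ Suc n
    \<and> (LINT x|lborel. \<bar>conv_power f n x\<bar>) \<le> (LINT x|lborel. \<bar>f x\<bar>) ^ Suc n"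
proof (induction n)
  case 0
  then show ?case using f by simp
next
  case (Suc n)
  have "(LINT x|lborel. \<bar>f x\<bar>) * (LINT x|lborel. \<bar>conv_power f n x\<bar>)
      \<le> (LINT x|lborel. \<bar>f x\<bar>) * (LINT x|lborel. \<bar>f x\<bar>) ^ Suc n"
    using Suc by (intro mult_left_mono) auto
  then show ?case
    using conv_integrable[OF f, of "conv_power f n"] Suc by auto
qed

text \<open>
  Exponential weights are multiplicative for convolution; they turn an integral of a convolution power
  into a power of a Laplace transform.
\<close>

lemma conv_power_exp:
  "conv_power (\<lambda>x. exp (- s * x) * f x) n = (\<lambda>x. exp (- s * x) * conv_power f n x)"
proof (induction n)
  case (Suc n)
  have "exp (- s * y) * f y * (exp (- s * (x - y)) * conv_power f n (x - y))
      = exp (- s * x) * (f y * conv_power f n (x - y))" for x y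
  proof -
    have "exp (- s * x) = exp (- s * y) * exp (- s * (x - y))"
      by (simp add: exp_add[symmetric] algebra_simps)
    then show ?thesis by simp
  qed
  then show ?case
    by (simp only: conv_power.simps Suc conv_def[abs_def] Bochner_Integration.integral_mult_right_zero)
qed simp

text \<open>
  Differentiating a power by the Leibniz rule produces the factor \<open>n + 1\<close>; the remaining \<open>n\<close> factors
  contribute their \<open>L\<^sup>1\<close> norm \<open>r\<close>.
\<close>

lemma tame_conv_power:
  assumes f: "tame N f" and r: "r = (LINT x|lborel. \<bar>f x\<bar>)"
  shows "tame (real (Suc n) * N * r ^ n) (conv_power f n)"
proof (induction n)
  case 0
  then show ?case using f by simp
next
  case (Suc n)
  have "0 \<le> N" using f by (auto simp: tame_def intro: order_trans[OF abs_ge_zero])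
  have "(LINT x|lborel. \<bar>conv_power f n x\<bar>) \<le> r ^ Suc n"
    using conv_power_integrable[of f n] f r by (simp add: tame_def)
  then have "N * (LINT x|lborel. \<bar>conv_power f n x\<bar>) \<le> N * r ^ Suc n"
    using \<open>0 \<le> N\<close> by (rule mult_left_mono)
  then have "N * (LINT x|lborel. \<bar>conv_power f n x\<bar>) + real (Suc n) * N * r ^ n * (LINT x|lborel. \<bar>f x\<bar>)
      \<le> real (Suc (Suc n)) * N * r ^ Suc n"
    by (simp add: r[symmetric] algebra_simps)
  then show ?case
    using tame_conv[OF f Suc] unfolding tame_def by (auto intro: order_trans)
qed

text \<open>
  The bounds of the convolution powers multiplied by \<open>x\<close> are summable, as \<open>\<Sum> (n + 1) r\<^sup>n\<close> converges; so
  the series multiplied by \<open>x\<close> converges uniformly, which gives continuity away from the origin. The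
  \<open>L\<^sup>1\<close> norms are dominated by a geometric series, which permits the integration term by term.
\<close>

lemma neumann_series:
  assumes f: "tame N f" and r: "r = (LINT x|lborel. \<bar>f x\<bar>)" "r < 1"
  defines "h \<equiv> \<lambda>x. \<Sum>n. conv_power f n x"
  shows "continuous_on {0<..} h"
    and "x \<le> 0 \<Longrightarrow> h x = 0"
    and "0 \<le> s \<Longrightarrow> \<bar>LINT x|lborel. exp (- s * x) * f x\<bar> < 1"
    and "0 \<le> s \<Longrightarrow> has_bochner_integral lborel (\<lambda>x. exp (- s * x) * h x)
          ((LINT x|lborel. exp (- s * x) * f x) / (1 - (LINT x|lborel. exp (- s * x) * f x)))"
proof -
  have "0 \<le> r" by (simp add: r)
  have f0: "f x = 0" if "x \<le> 0" for x using f that by (simp add: tame_def)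
  have fi: "integrable lborel f" using f by (simp add: tame_def)
  have [measurable]: "f \<in> borel_measurable borel" using fi by (simp add: borel_measurable_integrable)
  have tame: "tame (real (Suc n) * N * r ^ n) (conv_power f n)" for n
    using tame_conv_power[OF f r(1)] .
  have bound: "\<bar>x * conv_power f n x\<bar> \<le> real (Suc n) * N * r ^ n" for n x
    using tame[of n] by (simp add: tame_def)
  have sumN: "summable (\<lambda>n. real (Suc n) * N * r ^ n)"
    using geometric_deriv_sums[of r] \<open>0 \<le> r\<close> r(2)
    by (auto simp: sums_iff mult_ac intro!: summable_mult2 dest: summable_mult[of _ N])
  have zero: "conv_power f n x = 0" if "x \<le> 0" for n x
    using tame[of n] that by (simp add: tame_def)
  have sum_abs: "summable (\<lambda>n. \<bar>conv_power f n x\<bar>)" for x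
  proof (cases "x \<le> 0")
    case True
    then show ?thesis using zero by simp
  next
    case False
    have "summable (\<lambda>n. \<bar>x * conv_power f n x\<bar>)"
      using bound by (intro summable_comparison_test'[OF sumN, of 0]) simp
    then have "summable (\<lambda>n. \<bar>x * conv_power f n x\<bar> / \<bar>x\<bar>)" by (rule summable_divide)
    then show ?thesis using False by (simp add: abs_mult)
  qed
  show "h x = 0" if "x \<le> 0" for x using zero[OF that] by (simp add: h_def)
  have "continuous_on {0<..} (\<lambda>x. \<Sum>n. x * conv_power f n x)"
  proof (rule uniform_limit_theorem)
    show "uniform_limit {0<..} (\<lambda>n x. \<Sum>i<n. x * conv_power f i x) (\<lambda>x. \<Sum>n. x * conv_power f n x) sequentially"
      using bound sumN by (intro Weierstrass_m_test[where M="\<lambda>n. real (Suc n) * N * r ^ n"]) auto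
    show "\<forall>\<^sub>F n in sequentially. continuous_on {0<..} (\<lambda>x. \<Sum>i<n. x * conv_power f i x)"
      using tame by (intro always_eventually allI continuous_intros) (auto simp: tame_def)
  qed simp
  moreover have "(\<Sum>n. x * conv_power f n x) = x * h x" for x
    unfolding h_def using sum_abs[of x] by (intro suminf_mult) (rule summable_rabs_cancel)
  ultimately have "continuous_on {0<..} (\<lambda>x. x * h x / x)"
    by (intro continuous_on_divide continuous_on_id) auto
  then show "continuous_on {0<..} h"
    by (rule continuous_on_eq) simp
  assume "0 \<le> s"
  let ?g = "\<lambda>x. exp (- s * x) * f x"
  have le: "\<bar>?g x\<bar> \<le> \<bar>f x\<bar>" for x
    using f0[of x] \<open>0 \<le> s\<close> by (cases "x \<le> 0") (auto simp: abs_mult intro!: mult_left_le_one_le)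
  have gi: "integrable lborel ?g"
    by (rule Bochner_Integration.integrable_bound[OF fi]) (use le in auto)
  have gr: "(LINT x|lborel. \<bar>?g x\<bar>) \<le> r"
    unfolding r using gi fi le by (intro integral_mono) auto
  then have g1: "\<bar>LINT x|lborel. ?g x\<bar> \<le> r"
    by (rule order_trans[OF integral_abs_bound])
  then show "\<bar>LINT x|lborel. ?g x\<bar> < 1" using r(2) by simp
  let ?p = "\<lambda>n x. exp (- s * x) * conv_power f n x"
  note p = conv_power_integrable[OF gi, unfolded conv_power_exp]
  have pabs: "summable (\<lambda>n. norm (?p n x))" for x
    using summable_mult[OF sum_abs[of x], of "exp (- s * x)"] by (simp add: abs_mult)
  have "summable (\<lambda>n. LINT x|lborel. norm (?p n x))"
  proof (rule summable_comparison_test'[where N=0])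
    show "summable (\<lambda>n. r ^ Suc n)"
      using \<open>0 \<le> r\<close> r(2) summable_geometric[of r] by (subst summable_Suc_iff) simp
    show "norm (LINT x|lborel. norm (?p n x)) \<le> r ^ Suc n" for n
    proof -
      have "(LINT x|lborel. \<bar>?p n x\<bar>) \<le> (LINT x|lborel. \<bar>?g x\<bar>) ^ Suc n"
        using p[of n] by blast
      also have "\<dots> \<le> r ^ Suc n" using gr by (intro power_mono) auto
      finally show ?thesis by simp
    qed
  qed
  note suminf = integrable_suminf[of lborel ?p, OF _ AE_I2[OF pabs] this]
    integral_suminf[of lborel ?p, OF _ AE_I2[OF pabs] this]
  have hp: "(\<Sum>n. ?p n x) = exp (- s * x) * h x" for x
    unfolding h_def using sum_abs[of x] by (intro suminf_mult) (rule summable_rabs_cancel)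
  have "(\<Sum>n. (LINT x|lborel. ?g x) ^ Suc n) = (LINT x|lborel. ?g x) / (1 - (LINT x|lborel. ?g x))"
    using geometric_sums[of "LINT x|lborel. ?g x"] g1 r(2)
    by (simp add: sums_iff suminf_mult)
  then show "has_bochner_integral lborel (\<lambda>x. exp (- s * x) * h x)
      ((LINT x|lborel. ?g x) / (1 - (LINT x|lborel. ?g x)))"
    using suminf p by (simp only: hp has_bochner_integral_iff conj_absorb simp_thms)
qed

section \<open>Laplace transforms and antiderivatives\<close>

definition has_laplace :: "(real \<Rightarrow> real) \<Rightarrow> real \<Rightarrow> real \<Rightarrow> bool" where
  "has_laplace f \<theta> L \<longleftrightarrow> has_bochner_integral lborel (\<lambda>x. indicator {0..} x * (exp (- \<theta> * x) * f x)) L"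

lemma has_laplace_add:
  "has_laplace f \<theta> K \<Longrightarrow> has_laplace g \<theta> L \<Longrightarrow> has_laplace (\<lambda>x. f x + g x) \<theta> (K + L)"
  unfolding has_laplace_def using has_bochner_integral_add by (fastforce simp: algebra_simps)

lemma has_laplace_cmult:
  "has_laplace f \<theta> K \<Longrightarrow> has_laplace (\<lambda>x. c * f x) \<theta> (c * K)"
  unfolding has_laplace_def
  using has_bochner_integral_mult_right[of c lborel "\<lambda>x. indicator {0..} x * (exp (- \<theta> * x) * f x)" K]
  by (simp add: mult_ac)

lemma has_laplace_one:
  assumes "0 < \<theta>"
  shows "has_laplace (\<lambda>x. 1) \<theta> (1 / \<theta>)"
proof -
  have "((\<lambda>x. - exp (- \<theta> * x) / \<theta>) \<longlongrightarrow> - 0 / \<theta>) at_top"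
    using assms by (intro tendsto_intros filterlim_compose[OF exp_at_bot])
      (auto simp: filterlim_uminus_at_bot intro: filterlim_tendsto_pos_mult_at_top filterlim_ident)
  then have "(\<integral>\<^sup>+x. ennreal (exp (- \<theta> * x)) * indicator {0..} x \<partial>lborel) = ennreal (- 0 / \<theta> - - exp (- \<theta> * 0) / \<theta>)"
    using assms by (intro nn_integral_FTC_atLeast) (auto intro!: derivative_eq_intros)
  then have "has_bochner_integral lborel (\<lambda>x. exp (- \<theta> * x) * indicator {0..} x) (1 / \<theta>)"
    using assms by (intro has_bochner_integral_nn_integral)
      (auto simp: ennreal_mult ennreal_indicator)
  then show ?thesis by (simp add: has_laplace_def mult.commute)
qed

text \<open>
  The weighted antiderivative is the convolution of the weighted function with \<open>e\<^sup>-\<^sup>\<theta>\<^sup>x\<close> on the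
  half-line, whose integral is \<open>1 / \<theta>\<close>.
\<close>

lemma has_laplace_antiderivative:
  assumes v: "has_laplace v \<theta> L" and "0 < \<theta>"
  shows "has_laplace (\<lambda>x. LINT y:{0..x}|lborel. v y) \<theta> (L / \<theta>)"
proof -
  let ?E = "\<lambda>x. indicator {0..} x * exp (- \<theta> * x) :: real"
  let ?G = "\<lambda>x. indicator {0..} x * (exp (- \<theta> * x) * v x)"
  have E: "has_bochner_integral lborel ?E (1 / \<theta>)"
    using has_laplace_one[OF \<open>0 < \<theta>\<close>] by (simp add: has_laplace_def)
  have G: "has_bochner_integral lborel ?G L" using v by (simp add: has_laplace_def)
  have eq: "conv ?G ?E x = indicator {0..} x * (exp (- \<theta> * x) * (LINT y:{0..x}|lborel. v y))" for x
  proof -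
    have "?G y * ?E (x - y) = (indicator {0..} x * exp (- \<theta> * x)) * (indicator {0..x} y *\<^sub>R v y)" for y
    proof -
      have "exp (- \<theta> * x) = exp (- \<theta> * y) * exp (- \<theta> * (x - y))"
        by (simp add: exp_add[symmetric] algebra_simps)
      then show ?thesis by (auto simp: indicator_def)
    qed
    then show ?thesis
      by (simp only: conv_def set_lebesgue_integral_def Bochner_Integration.integral_mult_right_zero mult.assoc)
  qed
  have "has_bochner_integral lborel (conv ?G ?E) (L / \<theta>)"
    using conv_integrable(1,2)[of ?G ?E] E G by (simp only: has_bochner_integral_iff) simp
  then show ?thesis by (simp only: has_laplace_def eq[abs_def])
qed

lemma has_laplace_imp_set_integrable:
  assumes v: "has_laplace v \<theta> L"
  shows "set_integrable lborel {0..b} v"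
proof -
  let ?G = "\<lambda>x. indicator {0..} x * (exp (- \<theta> * x) * v x)"
  have G: "integrable lborel ?G" using v by (simp add: has_laplace_def has_bochner_integral_iff)
  have eq: "indicator {0..b} x *\<^sub>R v x = indicator {0..b} x * exp (\<theta> * x) * ?G x" for x
  proof -
    have "exp (\<theta> * x) * exp (- \<theta> * x) = 1" by (simp add: exp_add[symmetric])
    then show ?thesis by (auto simp: indicator_def mult.assoc[symmetric])
  qed
  have [measurable]: "?G \<in> borel_measurable borel" using G by (simp add: borel_measurable_integrable)
  have "integrable lborel (\<lambda>x. indicator {0..b} x * exp (\<theta> * x) * ?G x)"
  proof (rule Bochner_Integration.integrable_bound[where f="\<lambda>x. exp (\<bar>\<theta>\<bar> * \<bar>b\<bar>) * ?G x"])
    have "\<bar>indicator {0..b} x * exp (\<theta> * x)\<bar> \<le> exp (\<bar>\<theta>\<bar> * \<bar>b\<bar>)" for x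
    proof (cases "x \<in> {0..b}")
      case True
      then have "\<theta> * x \<le> \<bar>\<theta>\<bar> * \<bar>b\<bar>" by (intro mult_mono) auto
      with True show ?thesis by simp
    qed simp
    then show "AE x in lborel. norm (indicator {0..b} x * exp (\<theta> * x) * ?G x) \<le> norm (exp (\<bar>\<theta>\<bar> * \<bar>b\<bar>) * ?G x)"
      unfolding norm_mult by (intro AE_I2 mult_right_mono) auto
  qed (use G in auto)
  then show ?thesis by (simp only: set_integrable_def eq)
qed

text \<open>
  The integrand may be unbounded at 0. The integral is therefore split at \<open>x / 2\<close>, and the fundamental
  theorem for continuous integrands is applied to the right part only.
\<close>

lemma antiderivative_has_derivative:
  fixes v :: "real \<Rightarrow> real"
  assumes int: "\<And>b. set_integrable lborel {0..b} v" and cont: "continuous_on {0<..} v" and "0 < x"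
  shows "((\<lambda>x. LINT y:{0..x}|lborel. v y) has_real_derivative v x) (at x)"
proof -
  define d where "d = x / 2"
  have d: "0 < d" "d < x" using \<open>0 < x\<close> by (auto simp: d_def)
  have "((\<lambda>z. integral {d..z} v) has_real_derivative v x) (at x within {d..x + 1})"
    using d by (intro integral_has_real_derivative continuous_on_subset[OF cont]) auto
  moreover have "at x within {d..x + 1} = at x"
    using d by (intro at_within_interior) auto
  ultimately have "((\<lambda>z. integral {0..d} v + integral {d..z} v) has_real_derivative v x) (at x)"
    by (auto intro!: derivative_eq_intros)
  moreover have "integral {0..d} v + integral {d..z} v = (LINT y:{0..z}|lborel. v y)" if "z \<in> {d<..}" for z
    using Henstock_Kurzweil_Integration.integral_combine[of 0 d z v] set_borel_integral_eq_integral[OF int[of z]] d that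
    by simp
  ultimately show ?thesis
    using d has_field_derivative_transform_within_open[of _ "v x" x "{d<..}"] by auto
qed

section \<open>Uniqueness of Laplace transforms\<close>

text \<open>
  Lerch's argument. In the variable \<open>t = e\<^sup>-\<^sup>x\<close> the hypothesis says that all moments vanish; by
  the Weierstrass approximation theorem the integral of \<open>g(e\<^sup>-\<^sup>x) f(x)\<close> then vanishes for every continuous \<open>g\<close>. If
  \<open>f\<close> were nonzero at a point, a bump \<open>g\<close> supported near that point would give a nonzero integral.
\<close>

lemma laplace_transform_zero_imp_zero:
  fixes f :: "real \<Rightarrow> real"
  assumes int: "set_integrable lborel {0..} f"
    and cont: "continuous_on {0<..} f"
    and zero: "\<And>n::nat. (LINT x:{0..}|lborel. exp (- real n * x) * f x) = 0"
    and "0 < x0"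
  shows "f x0 = 0"
proof (rule ccontr)
  assume nz: "f x0 \<noteq> 0"
  define F where "F x = indicator {0..} x * f x" for x :: real
  have F: "integrable lborel F"
    using int by (simp add: set_integrable_def F_def[abs_def])
  have Fm [measurable]: "F \<in> borel_measurable borel"
    using F by (simp add: borel_measurable_integrable)
  have Fzero: "(LINT x|lborel. exp (- real n * x) * F x) = 0" for n
    using zero[of n] by (simp add: set_lebesgue_integral_def F_def mult_ac)
  have bounded_mult: "integrable lborel (\<lambda>x. g (exp (- x)) * F x)"
    if g: "g \<in> borel_measurable borel" "\<And>t. 0 \<le> t \<Longrightarrow> t \<le> 1 \<Longrightarrow> \<bar>g t\<bar> \<le> B" for g :: "real \<Rightarrow> real" and B
  proof (rule Bochner_Integration.integrable_bound[where f="\<lambda>x. B * F x"])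
    show "AE x in lborel. norm (g (exp (- x)) * F x) \<le> norm (B * F x)"
    proof (rule AE_I2)
      fix x
      show "norm (g (exp (- x)) * F x) \<le> norm (B * F x)"
      proof (cases "0 \<le> x")
        case True
        then have "\<bar>g (exp (- x))\<bar> \<le> \<bar>B\<bar>" using g(2)[of "exp (-x)"] by simp
        then show ?thesis by (simp add: abs_mult mult_right_mono)
      qed (simp add: F_def)
    qed
  qed (use F g(1) in \<open>auto\<close>)
  have ig: "integrable lborel (\<lambda>x. u (exp (- x)) * F x)"
    if u: "continuous_on UNIV u" for u :: "real \<Rightarrow> real"
  proof -
    have "bounded (u ` {0..1})"
      by (intro compact_imp_bounded compact_continuous_image continuous_on_subset[OF u subset_UNIV]) auto
    then obtain B where "\<forall>t\<in>u ` {0..1}. norm t \<le> B" by (auto simp: bounded_iff)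
    then show ?thesis
      by (intro bounded_mult[of u B] borel_measurable_continuous_onI[OF u]) auto
  qed
  have continuous_zero: "(LINT x|lborel. g (exp (- x)) * F x) = 0"
    if g: "continuous_on UNIV g" for g :: "real \<Rightarrow> real"
  proof -
    have approx: "\<bar>LINT x|lborel. g (exp (- x)) * F x\<bar> \<le> e * (LINT x|lborel. \<bar>F x\<bar>)" if "0 < e" for e
    proof -
      obtain p where p: "real_polynomial_function p" "\<forall>t\<in>{0..1}. \<bar>g t - p t\<bar> < e"
        using Stone_Weierstrass_real_polynomial_function[OF compact_Icc continuous_on_subset[OF g subset_UNIV] \<open>0 < e\<close>]
        by (metis)
      then obtain a n where pa: "p = (\<lambda>t. \<Sum>i\<le>n::nat. a i * t ^ i)"
        unfolding real_polynomial_function_iff_sum by (elim exE)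
      have pow: "exp (- x) ^ i = exp (- real i * x)" for x i
        by (simp flip: exp_of_nat_mult)
      have pcont: "continuous_on UNIV p" unfolding pa by (intro continuous_intros)
      have int_pow: "integrable lborel (\<lambda>x. exp (- real i * x) * F x)" for i
        using bounded_mult[of "\<lambda>t. t ^ i" 1] by (simp add: power_le_one pow)
      have "p (exp (- x)) * F x = (\<Sum>i\<le>n. a i * (exp (- real i * x) * F x))" for x
        by (simp add: pa sum_distrib_right pow mult.assoc)
      then have pz: "(LINT x|lborel. p (exp (- x)) * F x) = 0"
        using int_pow Fzero by simp
      have "(LINT x|lborel. g (exp (- x)) * F x)
          = (LINT x|lborel. g (exp (- x)) * F x - p (exp (- x)) * F x)"
        using ig[OF g] ig[OF pcont] pz by simp
      also have "\<bar>\<dots>\<bar> \<le> (LINT x|lborel. e * \<bar>F x\<bar>)"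
      proof (rule order_trans[OF integral_abs_bound], rule integral_mono)
        fix x
        show "\<bar>g (exp (- x)) * F x - p (exp (- x)) * F x\<bar> \<le> e * \<bar>F x\<bar>"
        proof (cases "0 \<le> x")
          case True
          then have "\<bar>g (exp (- x)) - p (exp (- x))\<bar> \<le> e" using p(2) by (simp add: less_imp_le)
          then show ?thesis by (simp add: left_diff_distrib[symmetric] abs_mult mult_right_mono)
        qed (simp add: F_def)
      qed (use ig[OF g] ig[OF pcont] F in auto)
      finally show ?thesis by simp
    qed
    have "\<bar>LINT x|lborel. g (exp (- x)) * F x\<bar> \<le> 0"
    proof (rule field_le_epsilon)
      fix e :: real
      assume "0 < e"
      define A where "A = (LINT x|lborel. \<bar>F x\<bar>)"
      have "0 \<le> A" by (simp add: A_def)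
      have "\<bar>LINT x|lborel. g (exp (- x)) * F x\<bar> \<le> e / (1 + A) * A"
        using approx[of "e / (1 + A)"] \<open>0 < e\<close> \<open>0 \<le> A\<close> by (simp only: A_def[symmetric]) simp
      also have "\<dots> \<le> 0 + e"
        using \<open>0 < e\<close> \<open>0 \<le> A\<close> by (simp add: field_simps)
      finally show "\<bar>LINT x|lborel. g (exp (- x)) * F x\<bar> \<le> 0 + e" .
    qed
    then show ?thesis by simp
  qed
  define s where "s = sgn (f x0)"
  have "isCont f x0" using cont \<open>0 < x0\<close> by (simp add: continuous_on_eq_continuous_at)
  then have "eventually (\<lambda>x. 0 < s * f x) (nhds x0)"
  proof -
    assume "isCont f x0"
    then have "((\<lambda>x. s * f x) \<longlongrightarrow> s * f x0) (nhds x0)"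
      by (intro tendsto_intros) (simp add: continuous_at tendsto_at_iff_tendsto_nhds)
    moreover have "0 < s * f x0" using nz by (simp add: s_def zero_less_mult_iff sgn_if)
    ultimately show ?thesis by (rule order_tendstoD)
  qed
  moreover have "eventually (\<lambda>x. 0 < x) (nhds x0)"
    using eventually_nhds_in_open[of "{0<..}" x0] \<open>0 < x0\<close> by simp
  ultimately have "eventually (\<lambda>x. 0 < s * f x \<and> 0 < x) (nhds x0)"
    by (rule eventually_conj)
  then obtain d where d: "0 < d" "\<And>x. dist x x0 < d \<Longrightarrow> 0 < s * f x \<and> 0 < x"
    unfolding eventually_nhds_metric by blast
  \<comment> \<open>the positive part of a parabola whose roots correspond to \<open>x0 + d\<close> and \<open>x0 - d\<close> under \<open>t = exp (- x)\<close>\<close>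
  define g where "g t = s * max 0 ((t - exp (- (x0 + d))) * (exp (- (x0 - d)) - t))" for t
  have gx: "g (exp (- x)) * F x = max 0 ((exp (- x) - exp (- (x0 + d))) * (exp (- (x0 - d)) - exp (- x))) * (s * F x)" for x
    by (simp add: g_def)
  have bump_pos: "0 < (exp (- x) - exp (- (x0 + d))) * (exp (- (x0 - d)) - exp (- x)) \<longleftrightarrow> dist x x0 < d" for x
    using d(1) by (auto simp: zero_less_mult_iff dist_real_def)
  have pos: "0 < g (exp (- x)) * F x" if "dist x x0 < d" for x
  proof -
    have "0 < s * F x" using d(2)[OF that] by (simp add: F_def)
    then show ?thesis
      unfolding gx using bump_pos[of x] that by (auto simp only: less_max_iff_disj intro: mult_pos_pos[rotated])
  qed
  have nonneg: "0 \<le> g (exp (- x)) * F x" for x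
  proof (cases "dist x x0 < d")
    case True
    then show ?thesis using pos less_imp_le by blast
  next
    case False
    then show ?thesis using bump_pos[of x] by (simp add: gx max_absorb1 not_less)
  qed
  have gc: "continuous_on UNIV g" unfolding g_def by (intro continuous_intros)
  have "AE x in lborel. g (exp (- x)) * F x = 0"
    using integral_nonneg_eq_0_iff_AE[of lborel "\<lambda>x. g (exp (- x)) * F x"] nonneg continuous_zero[OF gc] ig[OF gc] by simp
  then have "AE x in lborel. x \<notin> {x0 - d<..<x0 + d}"
  proof eventually_elim
    case (elim x)
    then have "\<not> dist x x0 < d" using pos[of x] by linarith
    then show ?case by (auto simp: dist_real_def)
  qed
  then have "emeasure lborel {x0 - d<..<x0 + d} = 0"
    by (intro null_setsD1) (simp only: AE_iff_null_sets[of "{x0 - d<..<x0 + d}" lborel] sets_lborel borel_open open_greaterThanLessThan)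
  then show False using d(1) by simp
qed

text \<open>
  Lerch's argument applies to the difference weighted by \<open>e\<^sup>-\<^sup>b\<^sup>x\<close>, since its transform at a natural number \<open>n\<close>
  is that of the difference at \<open>b + n\<close>.
\<close>

lemma laplace_unique:
  assumes f: "continuous_on {0<..} f" "\<And>\<theta>. b \<le> \<theta> \<Longrightarrow> has_laplace f \<theta> (L \<theta>)"
    and g: "continuous_on {0<..} g" "\<And>\<theta>. b \<le> \<theta> \<Longrightarrow> has_laplace g \<theta> (L \<theta>)"
    and "0 < x"
  shows "f x = g x"
proof -
  have diff: "has_laplace (\<lambda>x. f x - g x) \<theta> 0" if "b \<le> \<theta>" for \<theta>
    using has_laplace_add[OF f(2)[OF that] has_laplace_cmult[OF g(2)[OF that], of "-1"]] by simp
  let ?D = "\<lambda>x. exp (- b * x) * (f x - g x)"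
  have "?D x = 0"
  proof (rule laplace_transform_zero_imp_zero[OF _ _ _ \<open>0 < x\<close>])
    show "set_integrable lborel {0..} ?D"
      using diff[of b] by (simp add: has_laplace_def has_bochner_integral_iff set_integrable_def)
    show "continuous_on {0<..} ?D" by (intro continuous_intros f g)
    fix n :: nat
    have "exp (- (b + real n) * x) = exp (- real n * x) * exp (- b * x)" for x
      by (simp add: exp_add[symmetric] algebra_simps)
    then have eq: "exp (- real n * x) * ?D x = exp (- (b + real n) * x) * (f x - g x)" for x
      by (simp only: mult.assoc)
    show "(LINT x:{0..}|lborel. exp (- real n * x) * ?D x) = 0"
      unfolding eq using diff[of "b + real n"]
      by (simp add: has_laplace_def has_bochner_integral_iff set_lebesgue_integral_def)
  qed
  then show ?thesis by simp
qed

section \<open>Twice differentiable solutions\<close>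

text \<open>
  This is the Volterra equation \<open>c W + k * W = x\<close> in terms of transforms. Its solution is \<open>x / c\<close> plus the twofold
  antiderivative of \<open>v\<close>, where \<open>v\<close> is \<open>1 / c\<close> times the Neumann series of \<open>- k / c\<close>. The exponential weight of
  rate \<open>\<beta>\<close> makes the series converge globally: the weighted \<open>L\<^sup>1\<close> norm of \<open>k\<close> tends to 0 as the rate tends to
  infinity, hence is below \<open>c\<close> for some rate. It is removed again in the definition of \<open>v\<close>.
\<close>

lemma C2_on_of_laplace:
  fixes k W :: "real \<Rightarrow> real"
  assumes "0 < c"
    and k_cont: "continuous_on {0<..} k"
    and k_bound: "\<And>y. 0 < y \<Longrightarrow> \<bar>y * k y\<bar> \<le> A * (1 + y\<^sup>2)"
    and k_laplace: "\<And>\<theta>. 0 < \<theta> \<Longrightarrow> has_laplace k \<theta> (K \<theta>)"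
    and W_cont: "continuous_on {0<..} W"
    and W_laplace: "\<And>\<theta>. \<theta>0 < \<theta> \<Longrightarrow> 0 < \<theta> \<Longrightarrow> has_laplace W \<theta> (1 / (\<theta>\<^sup>2 * (c + K \<theta>)))"
  shows "C2_on {0<..} W"
proof -
  \<comment> \<open>cutting at the open half-line makes the weighted function vanish at 0, where \<open>k\<close> is arbitrary\<close>
  define g where "g \<theta> y = indicator {0<..} y * (exp (- \<theta> * y) * k y)" for \<theta> y
  have g_has: "has_bochner_integral lborel (g \<theta>) (K \<theta>)" if "0 < \<theta>" for \<theta>
  proof -
    have L: "has_bochner_integral lborel (\<lambda>y. indicator {0..} y * (exp (- \<theta> * y) * k y)) (K \<theta>)"
      using k_laplace[OF that] by (simp add: has_laplace_def)
    then have [measurable]: "(\<lambda>y. indicator {0..} y * (exp (- \<theta> * y) * k y)) \<in> borel_measurable borel"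
      by (auto simp: has_bochner_integral_iff dest: borel_measurable_integrable)
    have eq: "g \<theta> = (\<lambda>y. indicator {0<..} y * (indicator {0..} y * (exp (- \<theta> * y) * k y)))"
      by (auto simp: g_def fun_eq_iff indicator_def)
    have "AE y in lborel. indicator {0..} y * (exp (- \<theta> * y) * k y) = g \<theta> y"
      using AE_lborel_singleton[of 0] by eventually_elim (auto simp: g_def indicator_def)
    then show ?thesis
      using L has_bochner_integral_cong_AE[of "\<lambda>y. indicator {0..} y * (exp (- \<theta> * y) * k y)" lborel "g \<theta>" "K \<theta>"]
      unfolding eq by simp
  qed
  have g_int: "integrable lborel (g \<theta>)" if "0 < \<theta>" for \<theta>
    using g_has[OF that] by (simp add: has_bochner_integral_iff)
  have "(\<lambda>n. LINT y|lborel. \<bar>g (1 + real n) y\<bar>) \<longlonglongrightarrow> (LINT y::real|lborel. 0)"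
  proof (rule integral_dominated_convergence[where w="\<lambda>y. \<bar>g 1 y\<bar>"])
    show "AE y in lborel. (\<lambda>n. \<bar>g (1 + real n) y\<bar>) \<longlonglongrightarrow> 0"
    proof (rule AE_I2)
      fix y :: real
      show "(\<lambda>n. \<bar>g (1 + real n) y\<bar>) \<longlonglongrightarrow> 0"
      proof (cases "0 < y")
        case True
        have "(\<lambda>n. exp (- y) ^ n * \<bar>exp (- y) * k y\<bar>) \<longlonglongrightarrow> 0 * \<bar>exp (- y) * k y\<bar>"
          using True by (intro tendsto_intros LIMSEQ_power_zero) auto
        moreover have "exp (- y) ^ n * \<bar>exp (- y) * k y\<bar> = \<bar>g (1 + real n) y\<bar>" for n
        proof -
          have "exp (- (1 + real n) * y) = exp (- y) ^ n * exp (- y)"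
            by (simp add: exp_of_nat_mult[symmetric] exp_add[symmetric] algebra_simps)
          then show ?thesis using True by (simp add: g_def abs_mult)
        qed
        ultimately show ?thesis by simp
      qed (simp add: g_def)
    qed
    show "AE y in lborel. norm \<bar>g (1 + real n) y\<bar> \<le> \<bar>g 1 y\<bar>" for n
      by (intro AE_I2) (auto simp: g_def indicator_def abs_mult left_diff_distrib intro!: mult_right_mono)
  qed (use g_int in \<open>auto dest: borel_measurable_integrable\<close>)
  then have "eventually (\<lambda>n. (LINT y|lborel. \<bar>g (1 + real n) y\<bar>) < c) sequentially"
    using \<open>0 < c\<close> by (intro order_tendstoD(2)) auto
  then obtain n where n: "(LINT y|lborel. \<bar>g (1 + real n) y\<bar>) < c"
    by (auto simp: eventually_sequentially)
  define \<beta> where "\<beta> = 1 + real n"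
  have "1 \<le> \<beta>" by (simp add: \<beta>_def)
  define f where "f y = - (1 / c) * g \<beta> y" for y
  define h where "h = (\<lambda>x. \<Sum>n. conv_power f n x)"
  have "0 \<le> A" using k_bound[of 1] by simp
  have f_tame: "tame (3 * A / c) f"
  proof -
    have "\<bar>y * f y\<bar> \<le> 3 * A / c" for y
    proof (cases "0 < y")
      case True
      have e2: "1 + y\<^sup>2 \<le> 3 * exp y"
        using exp_lower_Taylor_quadratic[of y] zero_le_power2[of y] True by linarith
      have "\<bar>y * g \<beta> y\<bar> = exp (- \<beta> * y) * \<bar>y * k y\<bar>"
        using True by (simp add: g_def abs_mult)
      also have "\<dots> \<le> exp (- y) * (A * (1 + y\<^sup>2))"
        using True \<open>1 \<le> \<beta>\<close> \<open>0 \<le> A\<close> by (intro mult_mono k_bound) auto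
      also have "\<dots> \<le> exp (- y) * (A * (3 * exp y))"
        using e2 \<open>0 \<le> A\<close> by (intro mult_left_mono) auto
      also have "\<dots> = 3 * A" by (simp add: exp_minus)
      finally have "\<bar>y * g \<beta> y\<bar> / c \<le> 3 * A / c"
        using \<open>0 < c\<close> by (intro divide_right_mono) auto
      then show ?thesis using \<open>0 < c\<close> by (simp add: f_def abs_mult)
    qed (use \<open>0 \<le> A\<close> \<open>0 < c\<close> in \<open>simp add: f_def g_def\<close>)
    moreover have "continuous_on {0<..} (\<lambda>y. - (1 / c) * (exp (- \<beta> * y) * k y))"
      by (intro continuous_intros k_cont)
    then have "continuous_on {0<..} f"
      by (rule continuous_on_eq) (simp add: f_def g_def)
    moreover have "integrable lborel f"
      unfolding f_def[abs_def] using g_int[of \<beta>] \<open>1 \<le> \<beta>\<close> by (intro integrable_mult_right) simp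
    moreover have "\<forall>y\<le>0. f y = 0" by (simp add: f_def g_def)
    ultimately show ?thesis by (simp add: tame_def)
  qed
  have f_norm: "(LINT y|lborel. \<bar>f y\<bar>) < 1"
    using n \<open>0 < c\<close> by (simp add: f_def abs_mult flip: \<beta>_def)
  note series = neumann_series[OF f_tame refl f_norm]
  define v where "v x = exp (\<beta> * x) * h x / c" for x
  have v_cont: "continuous_on {0<..} v"
    unfolding v_def by (intro continuous_intros series(1)[folded h_def]) (use \<open>0 < c\<close> in auto)
  have f_laplace: "(LINT y|lborel. exp (- (\<theta> - \<beta>) * y) * f y) = - K \<theta> / c" if "\<beta> \<le> \<theta>" for \<theta>
  proof -
    have "exp (- (\<theta> - \<beta>) * y) * f y = - (1 / c) * g \<theta> y" for y
    proof -
      have "exp (- \<theta> * y) = exp (- (\<theta> - \<beta>) * y) * exp (- \<beta> * y)"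
        by (simp add: exp_add[symmetric] algebra_simps)
      then show ?thesis by (simp add: f_def g_def)
    qed
    then show ?thesis
      using g_has[of \<theta>] that \<open>1 \<le> \<beta>\<close> by (simp add: has_bochner_integral_iff)
  qed
  have K_small: "\<bar>K \<theta> / c\<bar> < 1" if "\<beta> \<le> \<theta>" for \<theta>
    using series(3)[of "\<theta> - \<beta>"] f_laplace[OF that] that by simp
  have v_laplace: "has_laplace v \<theta> ((- K \<theta> / c) / (1 + K \<theta> / c) / c)" if "\<beta> \<le> \<theta>" for \<theta>
  proof -
    have "has_bochner_integral lborel (\<lambda>x. exp (- (\<theta> - \<beta>) * x) * h x) ((- K \<theta> / c) / (1 + K \<theta> / c))"
      using series(4)[of "\<theta> - \<beta>"] f_laplace[OF that] that by (simp add: h_def)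
    then have "has_bochner_integral lborel (\<lambda>x. exp (- (\<theta> - \<beta>) * x) * h x / c) ((- K \<theta> / c) / (1 + K \<theta> / c) / c)"
      by (rule has_bochner_integral_divide_zero)
    moreover have "exp (- (\<theta> - \<beta>) * x) * h x / c = indicator {0..} x * (exp (- \<theta> * x) * v x)" for x
    proof -
      have "exp (- (\<theta> - \<beta>) * x) = exp (- \<theta> * x) * exp (\<beta> * x)"
        by (simp add: exp_add[symmetric] algebra_simps)
      then show ?thesis using series(2)[of x] by (cases "x < 0") (auto simp: v_def h_def indicator_def)
    qed
    ultimately show ?thesis by (simp add: has_laplace_def)
  qed
  \<comment> \<open>the initial slope \<open>1 / c\<close> comes from the leading term \<open>x / c\<close>; it is a multiple of 1 to match the rule for transforms of multiples\<close>
  define w where "w x = 1 / c * 1 + (LINT y:{0..x}|lborel. v y)" for x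
  define U where "U x = (LINT y:{0..x}|lborel. w y)" for x
  have w_laplace: "has_laplace w \<theta> (1 / c * (1 / \<theta>) + (- K \<theta> / c) / (1 + K \<theta> / c) / c / \<theta>)" if "\<beta> \<le> \<theta>" for \<theta>
    unfolding w_def[abs_def] using that \<open>1 \<le> \<beta>\<close>
    by (intro has_laplace_add has_laplace_cmult has_laplace_one has_laplace_antiderivative v_laplace) auto
  have U_laplace: "has_laplace U \<theta> (1 / (\<theta>\<^sup>2 * (c + K \<theta>)))" if "\<beta> \<le> \<theta>" for \<theta>
  proof -
    have "has_laplace U \<theta> ((1 / c * (1 / \<theta>) + (- K \<theta> / c) / (1 + K \<theta> / c) / c / \<theta>) / \<theta>)"
      unfolding U_def[abs_def] using that \<open>1 \<le> \<beta>\<close> by (intro has_laplace_antiderivative w_laplace) auto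
    moreover have "c + K \<theta> \<noteq> 0"
      using K_small[OF that] \<open>0 < c\<close> by (auto simp: add_eq_0_iff2)
    then have "(1 / c * (1 / \<theta>) + (- K \<theta> / c) / (1 + K \<theta> / c) / c / \<theta>) / \<theta> = 1 / (\<theta>\<^sup>2 * (c + K \<theta>))"
      using that \<open>1 \<le> \<beta>\<close> \<open>0 < c\<close> by (simp add: divide_simps) (simp add: algebra_simps power2_eq_square)
    ultimately show ?thesis by simp
  qed
  have w_deriv: "(w has_real_derivative v x) (at x)" if "0 < x" for x
    unfolding w_def[abs_def]
    using antiderivative_has_derivative[OF has_laplace_imp_set_integrable[OF v_laplace[OF order_refl]] v_cont that]
    by (auto intro!: derivative_eq_intros)
  then have w_cont: "continuous_on {0<..} w"
    by (intro continuous_at_imp_continuous_on ballI) (auto intro: DERIV_isCont)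
  have U_deriv: "(U has_real_derivative w x) (at x)" if "0 < x" for x
    unfolding U_def[abs_def]
    by (rule antiderivative_has_derivative[OF has_laplace_imp_set_integrable[OF w_laplace[OF order_refl]] w_cont that])
  then have U_cont: "continuous_on {0<..} U"
    by (intro continuous_at_imp_continuous_on ballI) (auto intro: DERIV_isCont)
  have UW: "U x = W x" if "0 < x" for x
    using \<open>1 \<le> \<beta>\<close>
    by (intro laplace_unique[where b="max \<beta> (\<theta>0 + 1)" and L="\<lambda>\<theta>. 1 / (\<theta>\<^sup>2 * (c + K \<theta>))"]
        U_cont W_cont U_laplace W_laplace that) auto
  have "(W has_real_derivative w x) (at x)" if "0 < x" for x
    by (rule has_field_derivative_transform_within_open[OF U_deriv[OF that], of "{0<..}"])
      (use that UW in auto)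
  then show ?thesis
    unfolding C2_on_def using w_deriv v_cont by (intro exI[of _ w] exI[of _ v]) auto
qed

section \<open>The exponent as a Laplace transform\<close>

text \<open>
  The function whose Laplace transform is the contribution of a jump \<open>x < 0\<close> to the exponent divided by
  \<open>\<theta>\<^sup>2\<close>. For a small jump it is the ramp \<open>(\<bar>x\<bar> - y)\<^sup>+\<close>, because \<open>e\<^sup>\<theta>\<^sup>x - 1 - \<theta> x\<close> vanishes to second order at
  0. A large jump is not compensated; the difference \<open>\<theta> x\<close>, divided by \<open>\<theta>\<^sup>2\<close>, is the transform of
  the constant \<open>x\<close>, and adding this constant to the ramp leaves \<open>- min y \<bar>x\<bar>\<close>.
\<close>

definition jump_kernel :: "real \<Rightarrow> real \<Rightarrow> real" where
  "jump_kernel x y = max 0 (- x - y) - (if x \<le> - 1 then - x else 0)"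

text \<open>
  The bound separates the variables: the factor in \<open>x\<close> is integrable for a jump measure, and the
  factor in \<open>y\<close> grows like \<open>1 / y\<close> at the origin.
\<close>

lemma jump_kernel_bound:
  assumes "x < 0" "0 < y"
  shows "\<bar>jump_kernel x y\<bar> \<le> min 1 (x\<^sup>2) * (1 / y + y)"
proof (cases "x \<le> - 1")
  case True
  then have "1 \<le> x\<^sup>2" using abs_le_square_iff[of 1 x] by simp
  moreover have "\<bar>jump_kernel x y\<bar> \<le> y"
    using True assms by (auto simp: jump_kernel_def max_def)
  ultimately show ?thesis using assms by (simp add: min_absorb1 add_increasing)
next
  case False
  then have x2: "x\<^sup>2 \<le> 1" using assms by (simp add: abs_square_le_1)
  have "x * (x + y) + y * y = (x + y / 2)\<^sup>2 + 3 / 4 * y\<^sup>2"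
    by (simp add: power2_eq_square algebra_simps)
  then have "0 \<le> x * (x + y) + y * y" by (metis add_nonneg_nonneg zero_le_power2 mult_nonneg_nonneg divide_nonneg_nonneg zero_le_numeral)
  then have "(- x - y) * y \<le> x\<^sup>2" by (simp add: power2_eq_square algebra_simps)
  then have "- x - y \<le> x\<^sup>2 / y" using assms by (simp add: pos_le_divide_eq)
  then have "\<bar>jump_kernel x y\<bar> \<le> x\<^sup>2 / y"
    using False assms by (simp add: jump_kernel_def)
  also have "\<dots> \<le> x\<^sup>2 * (1 / y + y)" using assms by (simp add: distrib_left)
  finally show ?thesis using x2 by (simp add: min_absorb2)
qed

lemma has_laplace_ramp:
  assumes "0 < \<theta>" "0 \<le> z"
  shows "has_laplace (\<lambda>y. max 0 (z - y)) \<theta> ((exp (- \<theta> * z) - 1 + \<theta> * z) / \<theta>\<^sup>2)"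
proof -
  let ?F = "\<lambda>y. exp (- \<theta> * y) * (1 / \<theta>\<^sup>2 - (z - y) / \<theta>)"
  have "has_bochner_integral lborel (\<lambda>y. (exp (- \<theta> * y) * (z - y)) * indicator {0..z} y) (?F z - ?F 0)"
    using assms
    by (intro has_bochner_integral_FTC_Icc_real)
      (auto intro!: derivative_eq_intros continuous_intros simp: field_simps power2_eq_square)
  moreover have "(exp (- \<theta> * y) * (z - y)) * indicator {0..z} y
      = indicator {0..} y * (exp (- \<theta> * y) * max 0 (z - y))" for y
    by (auto simp: indicator_def)
  moreover have "?F z - ?F 0 = (exp (- \<theta> * z) - 1 + \<theta> * z) / \<theta>\<^sup>2"
    using assms by (simp add: field_simps power2_eq_square)
  ultimately show ?thesis by (simp only: has_laplace_def)
qed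

lemma has_laplace_jump_kernel:
  assumes "0 < \<theta>" "x < 0"
  shows "has_laplace (jump_kernel x) \<theta> ((exp (\<theta> * x) - 1 - \<theta> * x * indicator {-1<..} x) / \<theta>\<^sup>2)"
proof (cases "x \<le> - 1")
  case True
  have "has_laplace (\<lambda>y. max 0 (- x - y) + x * 1) \<theta> ((exp (- \<theta> * - x) - 1 + \<theta> * - x) / \<theta>\<^sup>2 + x * (1 / \<theta>))"
    using assms by (intro has_laplace_add has_laplace_ramp has_laplace_cmult has_laplace_one) auto
  moreover have "(\<lambda>y. max 0 (- x - y) + x * 1) = jump_kernel x"
    using True by (simp add: jump_kernel_def[abs_def])
  moreover have "(exp (- \<theta> * - x) - 1 + \<theta> * - x) / \<theta>\<^sup>2 + x * (1 / \<theta>) =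
      (exp (\<theta> * x) - 1 - \<theta> * x * indicator {-1<..} x) / \<theta>\<^sup>2"
    using True assms by (simp add: field_simps power2_eq_square)
  ultimately show ?thesis by simp
next
  case False
  have "jump_kernel x = (\<lambda>y. max 0 (- x - y))"
    using False by (simp add: jump_kernel_def[abs_def])
  then show ?thesis
    using False assms has_laplace_ramp[of \<theta> "- x"] by simp
qed

lemma exp_minus_quadratic_upper:
  fixes t :: real
  assumes "0 \<le> t"
  shows "exp (- t) - 1 + t \<le> t\<^sup>2 / 2"
proof -
  have pos: "0 < 1 - t + t\<^sup>2 / 2"
    using zero_le_power2[of "t - 1"] by (simp add: power2_eq_square algebra_simps)
  have "1 \<le> 1 + t ^ 4 / 4" by simp
  also have "\<dots> = (1 - t + t\<^sup>2 / 2) * (1 + t + t\<^sup>2 / 2)"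
    by (simp add: algebra_simps power2_eq_square power4_eq_xxxx)
  also have "\<dots> \<le> (1 - t + t\<^sup>2 / 2) * exp t"
    using pos exp_lower_Taylor_quadratic[OF assms] by (intro mult_left_mono) auto
  finally show ?thesis by (simp add: exp_minus field_simps)
qed

text \<open>
  For fixed \<open>x\<close> the kernel has constant sign on \<open>y \<ge> 0\<close>, so that the integral of its absolute value is the absolute
  value of the known transform.
\<close>

lemma jump_kernel_abs_integral:
  assumes "0 < \<theta>" "x < 0"
  shows "(LINT y|lborel. \<bar>indicator {0..} y * (exp (- \<theta> * y) * jump_kernel x y)\<bar>)
    \<le> (1 / 2 + 1 / \<theta>\<^sup>2) * min 1 (x\<^sup>2)"
proof -
  define e :: real where "e = (if x \<le> - 1 then - 1 else 1)"
  have "\<bar>indicator {0..} y * (exp (- \<theta> * y) * jump_kernel x y)\<bar>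
      = e * (indicator {0..} y * (exp (- \<theta> * y) * jump_kernel x y))" for y
  proof -
    have "\<bar>jump_kernel x y\<bar> = e * jump_kernel x y" if "0 \<le> y"
      using that assms by (auto simp: jump_kernel_def e_def max_def)
    then show ?thesis by (simp add: abs_mult indicator_def)
  qed
  then have eq: "(LINT y|lborel. \<bar>indicator {0..} y * (exp (- \<theta> * y) * jump_kernel x y)\<bar>)
      = e * ((exp (\<theta> * x) - 1 - \<theta> * x * indicator {-1<..} x) / \<theta>\<^sup>2)"
    using has_laplace_jump_kernel[OF assms]
    by (simp only: has_laplace_def has_bochner_integral_iff Bochner_Integration.integral_mult_right_zero)
  show ?thesis
  proof (cases "x \<le> - 1")
    case True
    then have "1 \<le> x\<^sup>2" using abs_le_square_iff[of 1 x] by simp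
    then have m: "min 1 (x\<^sup>2) = 1" by simp
    have "e * ((exp (\<theta> * x) - 1 - \<theta> * x * indicator {-1<..} x) / \<theta>\<^sup>2) = (1 - exp (\<theta> * x)) / \<theta>\<^sup>2"
      using True by (simp add: e_def minus_divide_left)
    also have "\<dots> \<le> 1 / \<theta>\<^sup>2" by (intro divide_right_mono) auto
    finally show ?thesis unfolding eq m by simp
  next
    case False
    then have m: "min 1 (x\<^sup>2) = x\<^sup>2" using assms by (simp add: abs_square_le_1 min_absorb2)
    have "e * ((exp (\<theta> * x) - 1 - \<theta> * x * indicator {-1<..} x) / \<theta>\<^sup>2) = (exp (- (- \<theta> * x)) - 1 + (- \<theta> * x)) / \<theta>\<^sup>2"
      using False by (simp add: e_def)
    also have "\<dots> \<le> ((- \<theta> * x)\<^sup>2 / 2) / \<theta>\<^sup>2"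
      using assms by (intro divide_right_mono exp_minus_quadratic_upper) (auto simp: mult_nonneg_nonpos)
    also have "\<dots> = 1 / 2 * x\<^sup>2" using assms by (simp add: power_mult_distrib)
    also have "\<dots> \<le> (1 / 2 + 1 / \<theta>\<^sup>2) * x\<^sup>2" by (intro mult_right_mono) auto
    finally show ?thesis unfolding eq m .
  qed
qed

text \<open>
  Dividing by \<open>min 1 x\<^sup>2\<close> allows the jump measure \<open>\<nu>\<close>, which may be infinite, to be replaced by the finite measure
  with density \<open>min 1 x\<^sup>2\<close> on the negative half-line.
\<close>

definition normalized_kernel :: "real \<Rightarrow> real \<Rightarrow> real" where
  "normalized_kernel x y = indicator {..<0} x * jump_kernel x y / min 1 (x\<^sup>2)"

lemma measurable_normalized_kernel [measurable]:
  "(\<lambda>p. normalized_kernel (fst p) (snd p)) \<in> borel_measurable (borel \<Otimes>\<^sub>M borel)"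
  unfolding normalized_kernel_def jump_kernel_def by measurable

lemma normalized_kernel_bound:
  assumes "0 < y"
  shows "\<bar>normalized_kernel x y\<bar> \<le> 1 / y + y"
proof (cases "x < 0")
  case True
  then have "0 < min 1 (x\<^sup>2)" by simp
  then show ?thesis
    using True jump_kernel_bound[OF True assms]
    by (simp add: normalized_kernel_def abs_mult pos_divide_le_eq mult.commute)
qed (use assms in \<open>simp add: normalized_kernel_def\<close>)

text \<open>
  The normalized kernel is bounded for \<open>y\<close> in a compact part of \<open>(0, \<infinity>)\<close>, uniformly in \<open>x\<close>, and its transforms
  in \<open>y\<close> converge absolutely, uniformly in \<open>x\<close>. As the measure is finite, dominated convergence and Fubini's theorem
  apply directly.
\<close>

lemma kernel_integral:
  assumes "finite_measure \<mu>" and sets[measurable_cong]: "sets \<mu> = sets borel"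
  defines "P \<equiv> \<lambda>y. LINT x|\<mu>. normalized_kernel x y"
  shows "0 < y \<Longrightarrow> \<bar>P y\<bar> \<le> (1 / y + y) * measure \<mu> (space \<mu>)"
    and "continuous_on {0<..} P"
    and "0 < \<theta> \<Longrightarrow> has_laplace P \<theta> (LINT x|\<mu>. indicator {..<0} x *
           ((exp (\<theta> * x) - 1 - \<theta> * x * indicator {-1<..} x) / \<theta>\<^sup>2) / min 1 (x\<^sup>2))"
proof -
  interpret finite_measure \<mu> by fact
  have [measurable]: "(\<lambda>x. normalized_kernel x y) \<in> borel_measurable borel" for y
    unfolding normalized_kernel_def jump_kernel_def by measurable
  show "\<bar>P y\<bar> \<le> (1 / y + y) * measure \<mu> (space \<mu>)" if "0 < y" for y
  proof -
    have "\<bar>P y\<bar> \<le> (LINT x|\<mu>. \<bar>normalized_kernel x y\<bar>)"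
      unfolding P_def by (rule integral_abs_bound)
    also have "\<dots> \<le> (LINT x|\<mu>. 1 / y + y)"
      using normalized_kernel_bound[OF that] that by (intro integral_mono') auto
    finally show ?thesis by (simp add: mult.commute)
  qed
  show "continuous_on {0<..} P"
  proof (rule continuous_on_sequentiallyI)
    fix u :: "nat \<Rightarrow> real" and a
    assume u: "\<forall>n. u n \<in> {0<..}" "u \<longlonglongrightarrow> a" and a: "a \<in> {0<..}"
    have "(\<lambda>n. 1 / u n + u n) \<longlonglongrightarrow> 1 / a + a"
      using a u by (intro tendsto_intros) auto
    then have "Bseq (\<lambda>n. 1 / u n + u n)"
      by (intro convergent_imp_Bseq) (auto simp: convergent_def)
    then obtain B where B: "\<And>n. norm (1 / u n + u n) \<le> B" by (auto simp: Bseq_def)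
    show "(\<lambda>n. P (u n)) \<longlonglongrightarrow> P a"
      unfolding P_def
    proof (rule integral_dominated_convergence[where w="\<lambda>_. B"])
      show "AE x in \<mu>. (\<lambda>n. normalized_kernel x (u n)) \<longlonglongrightarrow> normalized_kernel x a"
      proof (rule AE_I2)
        fix x
        show "(\<lambda>n. normalized_kernel x (u n)) \<longlonglongrightarrow> normalized_kernel x a"
          unfolding normalized_kernel_def jump_kernel_def divide_inverse by (intro tendsto_intros u)
      qed
      show "AE x in \<mu>. norm (normalized_kernel x (u n)) \<le> B" for n
        using normalized_kernel_bound[of "u n"] u(1) B[of n] by (intro AE_I2) (force intro: order_trans)
    qed auto
  qed
  assume \<theta>: "0 < \<theta>"
  interpret pair_sigma_finite \<mu> lborel ..
  let ?L = "\<lambda>x. indicator {..<0} x * ((exp (\<theta> * x) - 1 - \<theta> * x * indicator {-1<..} x) / \<theta>\<^sup>2) / min 1 (x\<^sup>2)"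
  let ?g = "\<lambda>x y. indicator {0..} y * (exp (- \<theta> * y) * normalized_kernel x y)"
  have g_eq: "?g x y = indicator {..<0} x / min 1 (x\<^sup>2) * (indicator {0..} y * (exp (- \<theta> * y) * jump_kernel x y))" for x y
    by (simp add: normalized_kernel_def)
  have g: "has_bochner_integral lborel (?g x) (?L x)" for x
  proof (cases "x < 0")
    case True
    show ?thesis
      unfolding g_eq
      using has_bochner_integral_mult_right[OF has_laplace_jump_kernel[OF \<theta> True, unfolded has_laplace_def],
          of "indicator {..<0} x / min 1 (x\<^sup>2)"]
      by (simp add: mult_ac)
  qed (simp add: normalized_kernel_def has_bochner_integral_zero)
  have pair: "integrable (\<mu> \<Otimes>\<^sub>M lborel) (\<lambda>(x, y). ?g x y)"
  proof (rule Fubini_integrable)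
    show m: "(\<lambda>(x, y). ?g x y) \<in> borel_measurable (\<mu> \<Otimes>\<^sub>M lborel)"
      unfolding normalized_kernel_def jump_kernel_def split_beta by measurable
    show "AE x in \<mu>. integrable lborel (\<lambda>y. case (x, y) of (x, y) \<Rightarrow> ?g x y)"
      using g by (simp add: has_bochner_integral_iff)
    have bd: "(LINT y|lborel. \<bar>?g x y\<bar>) \<le> 1 / 2 + 1 / \<theta>\<^sup>2" for x
    proof (cases "x < 0")
      case True
      then have pos: "0 < min 1 (x\<^sup>2)" by simp
      have "\<bar>?g x y\<bar> = 1 / min 1 (x\<^sup>2) * \<bar>indicator {0..} y * (exp (- \<theta> * y) * jump_kernel x y)\<bar>" for y
        unfolding g_eq using True pos by (simp add: abs_mult)
      then have "(LINT y|lborel. \<bar>?g x y\<bar>) = 1 / min 1 (x\<^sup>2) * (LINT y|lborel. \<bar>indicator {0..} y * (exp (- \<theta> * y) * jump_kernel x y)\<bar>)"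
        by (simp only: Bochner_Integration.integral_mult_right_zero)
      also have "\<dots> \<le> 1 / min 1 (x\<^sup>2) * ((1 / 2 + 1 / \<theta>\<^sup>2) * min 1 (x\<^sup>2))"
        using pos by (intro mult_left_mono jump_kernel_abs_integral \<theta> True) auto
      also have "\<dots> = 1 / 2 + 1 / \<theta>\<^sup>2"
      proof -
        have "1 / m * (B * m) = B" if "0 < m" for m B :: real using that by simp
        then show ?thesis using pos .
      qed
      finally show ?thesis .
    qed (simp add: normalized_kernel_def)
    show "integrable \<mu> (\<lambda>x. LINT y|lborel. norm (case (x, y) of (x, y) \<Rightarrow> ?g x y))"
    proof (rule integrable_const_bound[where B="1 / 2 + 1 / \<theta>\<^sup>2"])
      show "AE x in \<mu>. norm (LINT y|lborel. norm (case (x, y) of (x, y) \<Rightarrow> ?g x y)) \<le> 1 / 2 + 1 / \<theta>\<^sup>2"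
        using bd by simp
      show "(\<lambda>x. LINT y|lborel. norm (case (x, y) of (x, y) \<Rightarrow> ?g x y)) \<in> borel_measurable \<mu>"
        using m by measurable
    qed
  qed
  have eqP: "(LINT x|\<mu>. ?g x y) = indicator {0..} y * (exp (- \<theta> * y) * P y)" for y
    by (simp add: P_def)
  have "(LINT y|lborel. LINT x|\<mu>. ?g x y) = (LINT x|\<mu>. LINT y|lborel. ?g x y)"
    using Fubini_integral[OF pair] by simp
  also have "\<dots> = (LINT x|\<mu>. ?L x)"
    using g by (simp add: has_bochner_integral_iff)
  finally have "(LINT y|lborel. LINT x|\<mu>. ?g x y) = (LINT x|\<mu>. ?L x)" .
  moreover have "integrable lborel (\<lambda>y. LINT x|\<mu>. ?g x y)"
    using integrable_snd[OF pair] by simp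
  ultimately show "has_laplace P \<theta> (LINT x|\<mu>. ?L x)"
    unfolding has_laplace_def has_bochner_integral_iff eqP by (rule conjI[rotated])
qed

text \<open>
  Divided by \<open>\<theta>\<^sup>2\<close>, the drift \<open>a \<theta>\<close> is the transform of the constant \<open>a\<close>, the killing term \<open>- q\<close> that of
  \<open>- q y\<close>, and the jump integral that of the averaged jump kernel; the Gaussian term leaves the constant
  \<open>\<sigma>\<^sup>2 / 2\<close>.
\<close>

lemma laplace_of_levy_khintchine:
  assumes \<nu>: "negative_levy_measure \<nu>"
  obtains k A K where "continuous_on {0<..} k"
    and "\<And>y. 0 < y \<Longrightarrow> \<bar>y * k y\<bar> \<le> A * (1 + y\<^sup>2)"
    and "\<And>\<theta>. 0 < \<theta> \<Longrightarrow> has_laplace k \<theta> (K \<theta>)"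
    and "\<And>\<theta>. 0 < \<theta> \<Longrightarrow> levy_khintchine_exponent a \<sigma> \<nu> \<theta> - q = \<theta>\<^sup>2 * (\<sigma>\<^sup>2 / 2 + K \<theta>)"
proof
  have [measurable_cong]: "sets \<nu> = sets borel"
    and fin: "(\<integral>\<^sup>+x\<in>{..<0}. ennreal (min 1 (x\<^sup>2)) \<partial>\<nu>) < \<infinity>"
    using \<nu> by (auto simp: negative_levy_measure_def)
  define d :: "real \<Rightarrow> real" where "d x = indicator {..<0} x * min 1 (x\<^sup>2)" for x
  have "d \<in> borel_measurable \<nu>"
    unfolding d_def[abs_def] by measurable
  moreover have "AE x in \<nu>. 0 \<le> d x"
    by (simp add: d_def)
  ultimately have d: "d \<in> borel_measurable \<nu>" "AE x in \<nu>. 0 \<le> d x" .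
  define \<mu> where "\<mu> = density \<nu> (\<lambda>x. ennreal (d x))"
  have sets_\<mu>: "sets \<mu> = sets borel" using \<nu> by (simp add: \<mu>_def negative_levy_measure_def)
  have "emeasure \<mu> (space \<mu>) = (\<integral>\<^sup>+x. ennreal (d x) * indicator (space \<nu>) x \<partial>\<nu>)"
    unfolding \<mu>_def using d by (subst emeasure_density) (auto simp: space_density)
  also have "\<dots> = (\<integral>\<^sup>+x\<in>{..<0}. ennreal (min 1 (x\<^sup>2)) \<partial>\<nu>)"
    by (intro nn_integral_cong) (auto simp: d_def indicator_def)
  finally have "finite_measure \<mu>"
    using fin by (intro finite_measureI) auto
  note P = kernel_integral[OF this sets_\<mu>]
  let ?P = "\<lambda>y. LINT x|\<mu>. normalized_kernel x y"
  let ?G = "\<lambda>\<theta> x. exp (\<theta> * x) - 1 - \<theta> * x * indicator {-1<..} x :: real"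
  let ?m = "measure \<mu> (space \<mu>)"
  define J where "J \<theta> = (LINT x:{..<0}|\<nu>. ?G \<theta> x)" for \<theta>
  have J: "(LINT x|\<mu>. indicator {..<0} x * (?G \<theta> x / \<theta>\<^sup>2) / min 1 (x\<^sup>2)) = J \<theta> / \<theta>\<^sup>2" for \<theta>
  proof -
    have [measurable]: "(\<lambda>x. indicator {..<0} x * (?G \<theta> x / \<theta>\<^sup>2) / min 1 (x\<^sup>2)) \<in> borel_measurable \<nu>"
      by measurable
    have "(LINT x|\<mu>. indicator {..<0} x * (?G \<theta> x / \<theta>\<^sup>2) / min 1 (x\<^sup>2))
        = (LINT x|\<nu>. d x *\<^sub>R (indicator {..<0} x * (?G \<theta> x / \<theta>\<^sup>2) / min 1 (x\<^sup>2)))"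
      unfolding \<mu>_def using d by (intro integral_density) simp_all
    also have "\<dots> = (LINT x|\<nu>. indicator {..<0} x *\<^sub>R ?G \<theta> x / \<theta>\<^sup>2)"
      by (intro Bochner_Integration.integral_cong) (auto simp: d_def indicator_def min_def)
    also have "\<dots> = J \<theta> / \<theta>\<^sup>2" by (simp add: J_def set_lebesgue_integral_def)
    finally show ?thesis .
  qed
  \<comment> \<open>\<open>a\<close> is kept as a multiple of 1 and \<open>y\<close> as an antiderivative of 1, the forms to which the rules for transforms apply\<close>
  show "continuous_on {0<..} (\<lambda>y. a * 1 + (- q * (LINT z:{0..y}|lborel. 1) + ?P y))"
  proof -
    have "continuous_on {0<..} (\<lambda>y::real. a * 1 + (- q * y + ?P y))"
      by (intro continuous_intros P(2))
    then show ?thesis by (rule continuous_on_eq) (simp add: set_lebesgue_integral_def)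
  qed
  show "\<bar>y * (a * 1 + (- q * (LINT z:{0..y}|lborel. 1) + ?P y))\<bar> \<le> (\<bar>a\<bar> + \<bar>q\<bar> + ?m) * (1 + y\<^sup>2)" if "0 < y" for y :: real
  proof -
    have y: "y \<le> 1 + y\<^sup>2" using zero_le_power2[of "y - 1 / 2"] by (simp add: power2_eq_square algebra_simps)
    have "\<bar>y * (a + (- q * y + ?P y))\<bar> \<le> \<bar>y * a\<bar> + (\<bar>y * (q * y)\<bar> + \<bar>y * ?P y\<bar>)"
    proof -
      have "y * (a + (- q * y + ?P y)) = y * a + (- (y * (q * y)) + y * ?P y)"
        by (simp add: algebra_simps)
      then show ?thesis by linarith
    qed
    also have "\<dots> \<le> (1 + y\<^sup>2) * \<bar>a\<bar> + ((1 + y\<^sup>2) * \<bar>q\<bar> + (1 + y\<^sup>2) * ?m)"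
    proof (intro add_mono)
      show "\<bar>y * a\<bar> \<le> (1 + y\<^sup>2) * \<bar>a\<bar>"
        using that y by (simp add: abs_mult mult_right_mono)
      have "\<bar>y * (q * y)\<bar> = y\<^sup>2 * \<bar>q\<bar>"
        using that by (simp add: abs_mult power2_eq_square)
      then show "\<bar>y * (q * y)\<bar> \<le> (1 + y\<^sup>2) * \<bar>q\<bar>" by (simp add: mult_right_mono)
      have "\<bar>y * ?P y\<bar> \<le> y * ((1 / y + y) * ?m)"
        using P(1)[OF that] that by (simp add: abs_mult)
      also have "\<dots> = (1 + y\<^sup>2) * ?m" using that by (simp add: field_simps power2_eq_square)
      finally show "\<bar>y * ?P y\<bar> \<le> (1 + y\<^sup>2) * ?m" .
    qed
    finally show ?thesis using that by (simp add: set_lebesgue_integral_def algebra_simps)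
  qed
  show "has_laplace (\<lambda>y. a * 1 + (- q * (LINT z:{0..y}|lborel. 1) + ?P y)) \<theta>
      (a * (1 / \<theta>) + (- q * (1 / \<theta> / \<theta>) + J \<theta> / \<theta>\<^sup>2))" if "0 < \<theta>" for \<theta>
    using that P(3)[OF that, unfolded J]
    by (intro has_laplace_add has_laplace_cmult has_laplace_one has_laplace_antiderivative)
  show "levy_khintchine_exponent a \<sigma> \<nu> \<theta> - q
      = \<theta>\<^sup>2 * (\<sigma>\<^sup>2 / 2 + (a * (1 / \<theta>) + (- q * (1 / \<theta> / \<theta>) + J \<theta> / \<theta>\<^sup>2)))" if "0 < \<theta>" for \<theta>
  proof -
    have "levy_khintchine_exponent a \<sigma> \<nu> \<theta> = a * \<theta> + \<sigma>\<^sup>2 * \<theta>\<^sup>2 / 2 + J \<theta>"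
      by (simp only: levy_khintchine_exponent_def J_def)
    then show ?thesis using that by (simp add: field_simps power2_eq_square)
  qed
qed

section \<open>Smoothness of the scale function\<close>

theorem theorem1:
  fixes M :: "'w measure" and X :: "real \<Rightarrow> 'w \<Rightarrow> real"
    and \<psi> :: "real \<Rightarrow> real" and a \<sigma> q :: real and \<nu> :: "real measure"
    and W :: "real \<Rightarrow> real"
  assumes "spectrally_negative_levy_process M X"
    and "has_laplace_exponent M X \<psi>"
    and "negative_levy_measure \<nu>"
    and "\<forall>\<theta>\<ge>0. \<psi> \<theta> = levy_khintchine_exponent a \<sigma> \<nu> \<theta>"
    and "0 < \<sigma>"
    and "0 \<le> q"
    and "is_scale_function \<psi> q W"
  shows "C2_on {0<..} W"
proof -
  obtain k A K where k: "continuous_on {0<..} k"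
    "\<And>y. 0 < y \<Longrightarrow> \<bar>y * k y\<bar> \<le> A * (1 + y\<^sup>2)"
    "\<And>\<theta>. 0 < \<theta> \<Longrightarrow> has_laplace k \<theta> (K \<theta>)"
    "\<And>\<theta>. 0 < \<theta> \<Longrightarrow> levy_khintchine_exponent a \<sigma> \<nu> \<theta> - q = \<theta>\<^sup>2 * (\<sigma>\<^sup>2 / 2 + K \<theta>)"
    using laplace_of_levy_khintchine[OF assms(3), of a \<sigma> q] by blast
  show ?thesis
  proof (rule C2_on_of_laplace[OF _ k(1-3)])
    show "0 < \<sigma>\<^sup>2 / 2" using assms(5) by simp
    show "continuous_on {0<..} W"
      using assms(7) by (auto simp: is_scale_function_def intro: continuous_on_subset)
    show "has_laplace W \<theta> (1 / (\<theta>\<^sup>2 * (\<sigma>\<^sup>2 / 2 + K \<theta>)))" if "largest_root \<psi> q < \<theta>" "0 < \<theta>" for \<theta>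
      using assms(4,7) that k(4)[of \<theta>]
      by (simp add: is_scale_function_def has_laplace_def has_bochner_integral_iff
          set_integrable_def set_lebesgue_integral_def)
  qed
qed

end
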